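(* Let $\mathbf P=(P,\leq,{}',0,1)$ be an orthogonal mlb-complete poset, and for $x,y\in P$ put $x\rightarrow_I y:=y\vee\operatorname{Max}L(x',y')$. Then the following conditions are equivalent: (i) There exists a binary operator $\odot_I\colon P^2\to 2^P$ such that for all $x,y,z\in P$, $x\odot_I y\leq z$ if and only if $x\leq y\rightarrow_I z$. (ii) $\mathbf P$ is a Boolean algebra (with ${}'$ as its complementation).
   Context: For a poset $(P,\leq)$, $L(x,y)$ is the set of common lower bounds of $x,y$; $\operatorname{Max}A$ is the set of maximal elements of $A$. For $A,B\subseteq P$, $A\leq B$ means $x\leq y$ for all $x\in A,y\in B$; elements are identified with singletons. For $y\in P$, $A\subseteq P$: $y\vee A:=\{y\vee a\mid a\in A\}$ (these suprema exist in the definition above by orthogonality). An antitone involution is a unary operation ${}'$ with $x''=x$ such that $x\leq y$ implies $y'\leq x'$. An orthogonal poset is a bounded poset $(P,\leq,{}',0,1)$ with an antitone involution such that $x\vee y$ exists whenever $x\leq y'$. A poset is mlb-complete if for every finite subset $M$ and every lower bound $x$ of $M$ there is a maximal lower bound of $M$ above (or equal to) $x$. *)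

theory Defs
  imports Main "HOL-Library.Lub_Glb"
begin

text \<open>
  The underlying poset is the type \<open>'a\<close> itself; the bounded poset \<open>(P, \<le>, 0, 1)\<close> is a type of
  sort \<open>{order_bot, order_top}\<close>, with \<open>bot\<close> and \<open>top\<close> in the role of \<open>0\<close> and \<open>1\<close>. A relation
  \<open>A \<le> B\<close> between sets of elements is only ever needed with a singleton on one side, where it
  is \<open>A *<= z\<close> or \<open>x <=* B\<close>; and \<open>lbs UNIV {x, y}\<close> is \<open>L(x, y)\<close>.
\<close>

definition maximals :: "'a::order set \<Rightarrow> 'a set" where
  "maximals A = {m \<in> A. \<forall>a\<in>A. m \<le> a \<longrightarrow> a = m}"

definition antitone_involution :: "('a::order \<Rightarrow> 'a) \<Rightarrow> bool" where
  "antitone_involution n \<longleftrightarrow> (\<forall>x. n (n x) = x) \<and> (\<forall>x y. x \<le> y \<longrightarrow> n y \<le> n x)"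

definition orthogonal_poset :: "('a::{order_bot,order_top} \<Rightarrow> 'a) \<Rightarrow> bool" where
  "orthogonal_poset n \<longleftrightarrow>
     antitone_involution n \<and> (\<forall>x y. x \<le> n y \<longrightarrow> (\<exists>s. isLub UNIV {x, y} s))"

definition mlb_complete :: "'a::order itself \<Rightarrow> bool" where
  "mlb_complete _ \<longleftrightarrow>
     (\<forall>M :: 'a set. finite M \<longrightarrow>
        (\<forall>x \<in> lbs UNIV M. \<exists>m \<in> maximals (lbs UNIV M). x \<le> m))"

text \<open>
  The supremum of two elements is unspecified when it does not exist. In \<open>impl_I\<close> below every
  \<open>a\<close> satisfies \<open>a \<le> n y\<close>, so for an orthogonal poset the suprema used there do exist.
\<close>

definition join :: "'a::order \<Rightarrow> 'a \<Rightarrow> 'a" where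
  "join x y = (THE s. isLub UNIV {x, y} s)"

definition impl_I :: "('a::order \<Rightarrow> 'a) \<Rightarrow> 'a \<Rightarrow> 'a \<Rightarrow> 'a set" where
  "impl_I n x y = join y ` maximals (lbs UNIV {n x, n y})"

text \<open>
  \<open>class.boolean_algebra\<close> is the library's predicate for the axioms of Boolean algebras. Order,
  bounds and complementation are the given ones; the difference operation, which is part of
  the library's signature, is the one its axioms force.
\<close>

definition is_boolean_algebra :: "('a::{order_bot,order_top} \<Rightarrow> 'a) \<Rightarrow> bool" where
  "is_boolean_algebra n \<longleftrightarrow>
     (\<exists>meet vee :: 'a \<Rightarrow> 'a \<Rightarrow> 'a.
        class.boolean_algebra (\<lambda>x y. meet x (n y)) n meet (\<le>) (<) vee bot top)"

end

theory Submission
  imports Defs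
begin

text \<open>
  Adjointness at \<open>z = 0\<close> gives \<open>y' \<le> y \<rightarrow> 0 \<le> y \<rightarrow> z\<close>. Hence \<open>z \<or> m\<close> is an upper bound
  of \<open>y'\<close> and \<open>z\<close> for every maximal \<open>m\<close> in \<open>L(y', z')\<close>, and since \<open>m \<le> y'\<close> it is the least one.
  So all joins exist, \<open>y \<rightarrow> z = y' \<or> z\<close>, and \<open>y = 0\<close> yields \<open>z \<or> z' = 1\<close>. It follows that
  \<open>x \<odot> y \<le> x\<close> and \<open>x \<odot> y \<le> y\<close>, so \<open>x \<and> y = 0\<close> forces \<open>x \<le> y'\<close>: the orthocomplement is a
  pseudocomplement, which makes an ortholattice distributive.
\<close>

lemma isLub_pair_iff:
  "isLub UNIV {x, y} s \<longleftrightarrow> x \<le> s \<and> y \<le> s \<and> (\<forall>w. x \<le> w \<longrightarrow> y \<le> w \<longrightarrow> s \<le> w)"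
  by (auto simp: isLub_def leastP_def isUb_def setle_def setge_def)

lemma mem_lbs_pair_iff: "x \<in> lbs UNIV {a, b} \<longleftrightarrow> x \<le> a \<and> x \<le> b"
  by (auto simp: lbs_def isLb_def setge_def)

lemma join_eqI: "isLub UNIV {x, y} s \<Longrightarrow> join x (y::'a::order) = s"
  unfolding join_def by (rule the_equality) (auto simp: isLub_pair_iff intro: antisym)

lemma isLub_join: "isLub UNIV {x, y} s \<Longrightarrow> isLub UNIV {x, y} (join x (y::'a::order))"
  by (simp add: join_eqI)

lemma maximals_eq_singleton:
  assumes "m \<in> A" "\<And>a. a \<in> A \<Longrightarrow> a \<le> m"
  shows "maximals A = {m}"
  using assms by (auto simp: maximals_def intro: antisym)

lemma antitone_involution_le_iff:
  assumes "antitone_involution n"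
  shows "n x \<le> n y \<longleftrightarrow> y \<le> x"
  using assms unfolding antitone_involution_def by metis

text \<open>Meets come from joins by De Morgan duality. Distributivity then rests on
  \<open>pc\<close>, which turns disjointness from an element into lying below its
  complement.\<close>

lemma pseudocomplemented_is_boolean_algebra:
  fixes n :: "'a::{order_bot,order_top} \<Rightarrow> 'a"
  assumes inv: "antitone_involution n"
    and ex: "\<And>x y :: 'a. \<exists>s. isLub UNIV {x, y} s"
    and disj: "\<And>x t. t \<le> x \<Longrightarrow> t \<le> n x \<Longrightarrow> t = bot"
    and pc: "\<And>x y. (\<And>t. t \<le> x \<Longrightarrow> t \<le> y \<Longrightarrow> t = bot) \<Longrightarrow> x \<le> n y"
  shows "is_boolean_algebra n"
proof -
  have nn [simp]: "n (n x) = x" for x using inv by (simp add: antitone_involution_def)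
  have le: "n x \<le> n y \<longleftrightarrow> y \<le> x" for x y by (rule antitone_involution_le_iff[OF inv])
  have J: "isLub UNIV {x, y} (join x y)" for x y :: 'a
    using ex[of x y] isLub_join[of x y] by auto
  have j1: "x \<le> join x y" and j2: "y \<le> join x y"
    and j3: "x \<le> w \<Longrightarrow> y \<le> w \<Longrightarrow> join x y \<le> w" for x y w :: 'a
    using J[of x y] by (auto simp: isLub_pair_iff)
  define meet where "meet x y = n (join (n x) (n y))" for x y
  have m1: "meet x y \<le> x" for x y using j1[of "n x" "n y"] le[of _ "n x"] by (simp add: meet_def)
  have m2: "meet x y \<le> y" for x y using j2[of "n y" "n x"] le[of _ "n y"] by (simp add: meet_def)
  have m3: "w \<le> x \<Longrightarrow> w \<le> y \<Longrightarrow> w \<le> meet x y" for x y w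
    using j3[of "n x" "n w" "n y"] le[of "n w"] by (simp add: meet_def le)
  have nbot: "n bot = top"
    using le[of "n top" bot] by (simp add: top_unique)
  have sub: "meet x (join y z) \<le> join (meet x y) (meet x z)" for x y z
  proof -
    let ?w = "join (meet x y) (meet x z)"
    \<comment> \<open>The double complement brings the goal into the form of \<open>pc\<close>: it
      suffices that only \<open>bot\<close> lies below both the left side and
      \<open>n ?w\<close>.\<close>
    have "meet x (join y z) \<le> n (n ?w)"
    proof (rule pc)
      fix t assume t: "t \<le> meet x (join y z)" "t \<le> n ?w"
      have tx: "t \<le> x" using t(1) m1 order_trans by blast
      have tj: "t \<le> join y z" using t(1) m2 order_trans by blast
      \<comment> \<open>Stated for a general \<open>v\<close> in order to be used at both
        \<open>y\<close> and \<open>z\<close>.\<close>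
      have "t \<le> n v" if v: "meet x v \<le> ?w" for v
      proof (rule pc)
        fix s assume s: "s \<le> t" "s \<le> v"
        have "s \<le> ?w" using m3[OF order_trans[OF s(1) tx] s(2)] v by (rule order_trans)
        moreover have "s \<le> n ?w" using s(1) t(2) by (rule order_trans)
        ultimately show "s = bot" by (rule disj)
      qed
      then have "t \<le> n y" "t \<le> n z" using j1 j2 by blast+
      then have "join y z \<le> n t" using le[of "n t" y] le[of "n t" z] by (intro j3) auto
      then have "t \<le> n (join y z)" using le[of "n t" "join y z"] by simp
      with tj show "t = bot" by (rule disj)
    qed
    then show ?thesis by simp
  qed
  interpret L: lattice meet "(\<le>)" "(<)" join
    by unfold_locales (fact m1 m2 m3 j1 j2 j3)+
  have "meet x (join y z) = join (meet x y) (meet x z)" for x y z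
    by (rule antisym[OF sub L.distrib_inf_le])
  then have distr: "join x (meet y z) = meet (join x y) (join x z)" for x y z
    by (rule L.distrib_imp1)
  have "class.boolean_algebra (\<lambda>x y. meet x (n y)) n meet (\<le>) (<) join bot top"
  proof unfold_locales
    fix x y z :: 'a
    show "join x (meet y z) = meet (join x y) (join x z)" by (rule distr)
    show "meet x (n x) = bot" using m1 m2 by (rule disj)
    \<comment> \<open>This element lies below both \<open>n x\<close> and \<open>x\<close>.\<close>
    have "n (join x (n x)) = bot"
      using le[of "join x (n x)" x] le[of "join x (n x)" "n x"] j1 j2
      by (intro disj[of _ x]) auto
    then show "join x (n x) = top" by (metis nbot nn)
  qed simp
  then show ?thesis unfolding is_boolean_algebra_def by blast
qed

text \<open>The lower bounds of \<open>n y\<close> and \<open>n z\<close> have a greatest element,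
  so \<open>impl_I n y z\<close> is the singleton of the classical implication
  \<open>vee (n y) z\<close>; shunting does the rest.\<close>

lemma boolean_algebra_impl_I:
  fixes n :: "'a::{order_bot,order_top} \<Rightarrow> 'a"
  assumes "class.boolean_algebra (\<lambda>x y. meet x (n y)) n meet (\<le>) (<) vee bot top"
  shows "x <=* impl_I n y z \<longleftrightarrow> meet x y \<le> z"
proof -
  interpret B: boolean_algebra "\<lambda>x y. meet x (n y)" n meet "(\<le>)" "(<)" vee bot top
    by (rule assms)
  have mx: "maximals (lbs UNIV {n y, n z}) = {meet (n y) (n z)}"
    by (rule maximals_eq_singleton) (auto simp: mem_lbs_pair_iff)
  have "join z (meet (n y) (n z)) = vee z (meet (n y) (n z))"
    by (rule join_eqI) (auto simp: isLub_pair_iff)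
  also have "\<dots> = vee (n y) z"
    by (simp add: B.sup_inf_distrib1 B.sup_commute B.sup_compl_top)
  finally have "impl_I n y z = {vee (n y) z}" by (simp add: impl_I_def mx)
  then show ?thesis
    by (simp add: setge_def B.shunt1)
qed

theorem theorem7p11:
  fixes n :: "'a::{order_bot,order_top} \<Rightarrow> 'a"
  assumes "orthogonal_poset n"
    and "mlb_complete TYPE('a)"
  shows "(\<exists>odot :: 'a \<Rightarrow> 'a \<Rightarrow> 'a set.
            \<forall>x y z. odot x y *<= z \<longleftrightarrow> x <=* impl_I n y z)
         \<longleftrightarrow> is_boolean_algebra n"
proof
  assume "is_boolean_algebra n"
  then obtain meet vee where
    "class.boolean_algebra (\<lambda>x y. meet x (n y)) n meet (\<le>) (<) vee bot top"
    unfolding is_boolean_algebra_def by blast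
  note impl = boolean_algebra_impl_I[OF this]
  show "\<exists>odot :: 'a \<Rightarrow> 'a \<Rightarrow> 'a set. \<forall>x y z. odot x y *<= z \<longleftrightarrow> x <=* impl_I n y z"
    by (rule exI[of _ "\<lambda>x y. {meet x y}"]) (simp add: impl setle_def)
next
  assume "\<exists>odot :: 'a \<Rightarrow> 'a \<Rightarrow> 'a set. \<forall>x y z. odot x y *<= z \<longleftrightarrow> x <=* impl_I n y z"
  then obtain odot :: "'a \<Rightarrow> 'a \<Rightarrow> 'a set"
    where adj: "\<And>x y z. odot x y *<= z \<longleftrightarrow> x <=* impl_I n y z" by blast
  have inv: "antitone_involution n"
    and orth: "\<And>x y. x \<le> n y \<Longrightarrow> \<exists>s. isLub UNIV {x, y} s"
    using assms(1) by (auto simp: orthogonal_poset_def)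
  have nn [simp]: "n (n x) = x" for x using inv by (simp add: antitone_involution_def)
  have le: "n x \<le> n y \<longleftrightarrow> y \<le> x" for x y by (rule antitone_involution_le_iff[OF inv])
  have nbot: "n bot = top"
    using le[of "n top" bot] by (simp add: top_unique)
  have mono: "odot x y *<= w" if "odot x y *<= z" "z \<le> w" for x y z w
    using that by (auto simp: setle_def intro: order_trans)
  have lub: "isLub UNIV {z, m} (join z m)" if "m \<le> n z" for z m
    using orth[OF that] isLub_join[of z m] by (auto simp: insert_commute)
  have compl_le: "n y <=* impl_I n y z" for y z
  proof -
    have "maximals (lbs UNIV {n y, n bot}) = {n y}"
      by (rule maximals_eq_singleton) (auto simp: mem_lbs_pair_iff nbot)
    moreover have "join bot (n y) = n y" by (rule join_eqI) (simp add: isLub_pair_iff)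
    ultimately have "n y <=* impl_I n y bot" by (simp add: impl_I_def setge_def)
    \<comment> \<open>Adjointness is used in both directions: upper bounds of
      \<open>odot (n y) y\<close> are closed upwards, so the case \<open>bot\<close> carries over to
      \<open>z\<close>.\<close>
    then show ?thesis using adj mono bot_least by blast
  qed
  have impl_lub: "isLub UNIV {n y, z} v" if v: "v \<in> impl_I n y z" for y z v
  proof -
    obtain m where m: "m \<le> n y" "m \<le> n z" and v_eq: "v = join z m"
      using v by (auto simp: impl_I_def maximals_def mem_lbs_pair_iff)
    have "n y \<le> v" using compl_le[of y z] v by (auto simp: setge_def)
    \<comment> \<open>Any upper bound of \<open>n y\<close> and \<open>z\<close> is also above
      \<open>m\<close>, hence above \<open>join z m\<close>.\<close>
    with lub[OF m(2)] show ?thesis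
      unfolding isLub_pair_iff v_eq using order_trans[OF m(1)] by blast
  qed
  have impl_ne: "\<exists>v. v \<in> impl_I n y z" for y z
  proof -
    \<comment> \<open>Here mlb-completeness enters: a maximal lower bound exists above
      \<open>bot\<close>.\<close>
    have "bot \<in> lbs UNIV {n y, n z}" by (simp add: mem_lbs_pair_iff)
    moreover have "finite {n y, n z}" by simp
    ultimately obtain m where "m \<in> maximals (lbs UNIV {n y, n z})"
      using assms(2) unfolding mlb_complete_def by blast
    then show ?thesis by (auto simp: impl_I_def)
  qed
  have sup_compl: "w = top" if w: "n z \<le> w" "z \<le> w" for z w
  proof -
    \<comment> \<open>Since \<open>n bot = top\<close>, \<open>compl_le\<close> forces every element
      of \<open>impl_I n bot z\<close> to be \<open>top\<close>, yet each is a join of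
      \<open>z\<close> with something below \<open>n z\<close>.\<close>
    obtain v where v: "v \<in> impl_I n bot z" using impl_ne by blast
    then have "v = top"
      using compl_le[of bot z] by (auto simp: setge_def nbot top_unique)
    moreover have "v \<le> w"
    proof -
      obtain m where "m \<le> n z" "v = join z m"
        using v by (auto simp: impl_I_def maximals_def mem_lbs_pair_iff)
      then show ?thesis
        using lub[of m z] w(2) order_trans[OF _ w(1), of m] unfolding isLub_pair_iff by blast
    qed
    ultimately show ?thesis by (simp add: top_unique)
  qed
  show "is_boolean_algebra n"
  proof (rule pseudocomplemented_is_boolean_algebra[OF inv])
    fix x y :: 'a
    show "\<exists>s. isLub UNIV {x, y} s"
      using impl_ne[of "n x" y] impl_lub[of _ "n x" y] by auto
  next
    fix x t assume "t \<le> x" "t \<le> n x"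
    then have "n t = top"
      using le[of x t] le[of "n x" t] by (intro sup_compl[of x]) auto
    then show "t = bot" by (metis nbot nn)
  next
    fix x y :: 'a assume *: "\<And>t. t \<le> x \<Longrightarrow> t \<le> y \<Longrightarrow> t = bot"
    have "x <=* impl_I n y x"
      using impl_lub[of _ y x] by (auto simp: setge_def isLub_pair_iff)
    then have 1: "odot x y *<= x" by (simp add: adj)
    \<comment> \<open>Elements of \<open>impl_I n y y\<close> lie above both \<open>n y\<close> and
      \<open>y\<close>, so they equal \<open>top\<close>.\<close>
    have "x <=* impl_I n y y"
      using impl_lub[of _ y y] sup_compl by (fastforce simp: setge_def isLub_pair_iff)
    then have "odot x y *<= y" by (simp add: adj)
    with 1 have "odot x y *<= bot" using * by (auto simp: setle_def)
    then have 2: "x <=* impl_I n y bot" by (simp add: adj)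
    \<comment> \<open>A witness is essential, as \<open>x <=* {}\<close> would hold vacuously; it is
      the supremum of \<open>n y\<close> and \<open>bot\<close>.\<close>
    obtain v where v: "v \<in> impl_I n y bot" using impl_ne by blast
    then have "x \<le> v" using 2 by (simp add: setge_def)
    also have "v \<le> n y" using impl_lub[OF v] by (simp add: isLub_pair_iff)
    finally show "x \<le> n y" .
  qed
qed

end
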